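(* Let $T$ be a trajectory in $\mathbb{R}^d$, let $\Delta\ge 0$, let $\ell \geq 2$ be an integer, and let $(S, f, g)$ be a pathlet-preserving simplification of $T$ (for $\Delta$). For any $(\ell, \Delta)$-pathlet $(P, \mathcal{I})$, there exists a subcurve $S[s, t]$ of $S$ such that $(S[s, t], \mathcal{I})$ is an $(\ell +2 - |\mathbb{N} \cap \{s, t\}|,\, 4\Delta)$-pathlet.
   Context: A (polygonal) curve (or trajectory) with $n$ vertices is a piecewise-linear map $P\colon[1,n]\to\mathbb{R}^d$ whose breakpoints (vertices) are at the integer parameters; $|P|=n$ denotes its number of vertices (its complexity). $P[a,b]$ is the subcurve of $P$ from $P(a)$ to $P(b)$; its vertices are its two endpoints and the vertices of $P$ at integer parameters in between. A reparameterization of $[1,n]$ is a non-decreasing surjection $f\colon[0,1]\to[1,n]$. A matching between curves $P,Q$ with $m$ and $n$ vertices is a pair $(f,g)$ of reparameterizations of $[1,m]$ and $[1,n]$; its cost is $\max_t \lVert P(f(t))-Q(g(t))\rVert$ (Euclidean norm). A matching of cost at most $\delta$ is a $\delta$-matching. The Fréchet distance $d_F(P,Q)$ is the minimum cost over all matchings. A matching $(f,g)$ between $S$ and $T$ matches $S[s,t]$ to $T[a,b]$ if there are $u\le v$ in $[0,1]$ with $f(u)=s$, $f(v)=t$, $g(u)=a$, $g(v)=b$. With $n=|T|$, an $(\ell,\Delta)$-pathlet is a tuple $(P,\mathcal{I})$ where $P$ is a curve with $|P|\le\ell$ (the reference curve) and $\mathcal{I}$ is a set of intervals in $[1,n]$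 with $d_F(P,T[a,b])\le\Delta$ for all $[a,b]\in\mathcal{I}$. A pathlet-preserving simplification of $T$ (for $\Delta$) is a curve $S$ together with a $2\Delta$-matching $(f,g)$ between $S$ and $T$ such that for any subtrajectory $T[a,b]$ of $T$ and all curves $P$ with $d_F(P,T[a,b])\le\Delta$, the subcurve $S[s,t]$ matched to $T[a,b]$ by $(f,g)$ has complexity $|S[s,t]|\le |P|+2-|\mathbb{N}\cap\{s,t\}|$. *)

theory Defs
  imports "HOL-Analysis.Analysis"
begin

text \<open>
  A curve with \<open>n\<close> vertices is a map on the real interval from 1 to \<open>n\<close> that is affine between
  consecutive integers. The values of \<open>point\<close> outside this interval are irrelevant.
  One-vertex curves are allowed.
\<close>

record 'a curve =
  complexity :: nat
  point :: "real \<Rightarrow> 'a"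

definition is_curve :: "'a::euclidean_space curve \<Rightarrow> bool" where
  "is_curve P \<longleftrightarrow> complexity P \<ge> 1 \<and>
     (\<forall>i u. 1 \<le> i \<and> i < complexity P \<and> 0 \<le> u \<and> u \<le> 1 \<longrightarrow>
        point P (real i + u) = (1 - u) *\<^sub>R point P (real i) + u *\<^sub>R point P (real (i + 1)))"

definition interpolate :: "(nat \<Rightarrow> real) \<Rightarrow> real \<Rightarrow> real" where
  "interpolate v x = (1 - frac x) * v (nat \<lfloor>x\<rfloor>) + frac x * v (nat \<lfloor>x\<rfloor> + 1)"

text \<open>
  The vertices of the subcurve from \<open>a\<close> to \<open>b\<close> sit at the parameters \<open>subcurve_params a b\<close>
  of the original curve (a single one if \<open>a = b\<close>). As a curve in its own right, the subcurve is
  reparameterized piecewise affinely so that its \<open>j\<close>-th vertex has parameter \<open>j\<close>.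
\<close>

definition subcurve_params :: "real \<Rightarrow> real \<Rightarrow> real set" where
  "subcurve_params a b = {a, b} \<union> (\<nat> \<inter> {a<..<b})"

definition subcurve :: "'a::euclidean_space curve \<Rightarrow> real \<Rightarrow> real \<Rightarrow> 'a curve" where
  "subcurve P a b =
     \<lparr> complexity = card (subcurve_params a b),
       point = (\<lambda>x. point P
         (interpolate (\<lambda>j. sorted_list_of_set (subcurve_params a b) ! (j - 1)) x)) \<rparr>"

text \<open>The bounds under which \<open>subcurve P a b\<close> is meaningful.\<close>

definition subcurve_range :: "'a::euclidean_space curve \<Rightarrow> real \<Rightarrow> real \<Rightarrow> bool" where
  "subcurve_range P a b \<longleftrightarrow> 1 \<le> a \<and> a \<le> b \<and> b \<le> real (complexity P)"

definition reparameterization :: "nat \<Rightarrow> (real \<Rightarrow> real) \<Rightarrow> bool" where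
  "reparameterization n f \<longleftrightarrow> mono_on {0..1} f \<and> f ` {0..1} = {1..real n}"

definition matching ::
  "'a::euclidean_space curve \<Rightarrow> 'a curve \<Rightarrow> (real \<Rightarrow> real) \<Rightarrow> (real \<Rightarrow> real) \<Rightarrow> bool" where
  "matching P Q f g \<longleftrightarrow>
     reparameterization (complexity P) f \<and> reparameterization (complexity Q) g"

text \<open>
  The supremum and the infimum are a maximum and a minimum for curves: matchings are continuous,
  and need only be non-decreasing, not strictly increasing.
\<close>

definition matching_cost ::
  "'a::euclidean_space curve \<Rightarrow> 'a curve \<Rightarrow> (real \<Rightarrow> real) \<Rightarrow> (real \<Rightarrow> real) \<Rightarrow> real" where
  "matching_cost P Q f g = (SUP t\<in>{0..1}. norm (point P (f t) - point Q (g t)))"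

definition frechet_dist :: "'a::euclidean_space curve \<Rightarrow> 'a curve \<Rightarrow> real" where
  "frechet_dist P Q = Inf {matching_cost P Q f g | f g. matching P Q f g}"

definition bounded_matching ::
  "real \<Rightarrow> 'a::euclidean_space curve \<Rightarrow> 'a curve \<Rightarrow> (real \<Rightarrow> real) \<Rightarrow> (real \<Rightarrow> real) \<Rightarrow> bool" where
  "bounded_matching \<delta> P Q f g \<longleftrightarrow> matching P Q f g \<and> matching_cost P Q f g \<le> \<delta>"

definition matches_subcurve ::
  "(real \<Rightarrow> real) \<Rightarrow> (real \<Rightarrow> real) \<Rightarrow> real \<Rightarrow> real \<Rightarrow> real \<Rightarrow> real \<Rightarrow> bool" where
  "matches_subcurve f g s t a b \<longleftrightarrow>
     (\<exists>u v. 0 \<le> u \<and> u \<le> v \<and> v \<le> 1 \<and> f u = s \<and> f v = t \<and> g u = a \<and> g v = b)"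

definition is_pathlet ::
  "'a::euclidean_space curve \<Rightarrow> nat \<Rightarrow> real \<Rightarrow> 'a curve \<times> real set set \<Rightarrow> bool" where
  "is_pathlet T l \<Delta> = (\<lambda>(P, \<I>).
     is_curve P \<and> complexity P \<le> l \<and>
     (\<forall>J\<in>\<I>. \<exists>a b. subcurve_range T a b \<and> J = {a..b} \<and>
        frechet_dist P (subcurve T a b) \<le> \<Delta>))"

text \<open>
  Where \<open>g\<close> is constant and \<open>f\<close> is not, several subcurves of \<open>S\<close> may be matched to the same subcurve
  of \<open>T\<close>; the bound is required of each of them. The natural-number subtraction never truncates,
  as the intersection has at most two elements.
\<close>

definition pathlet_preserving_simplification ::
  "'a::euclidean_space curve \<Rightarrow> real \<Rightarrow> 'a curve \<Rightarrow> (real \<Rightarrow> real) \<Rightarrow> (real \<Rightarrow> real) \<Rightarrow> bool" where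
  "pathlet_preserving_simplification T \<Delta> S f g \<longleftrightarrow>
     is_curve S \<and> bounded_matching (2 * \<Delta>) S T f g \<and>
     (\<forall>a b P s t. subcurve_range T a b \<and> is_curve P \<and>
        frechet_dist P (subcurve T a b) \<le> \<Delta> \<and> matches_subcurve f g s t a b \<longrightarrow>
        complexity (subcurve S s t) \<le> complexity P + 2 - card (\<nat> \<inter> {s, t}))"

end

theory Submission
  imports Defs
begin

text \<open>
  If the family of intervals is nonempty, pick any \<open>[a, b]\<close> in it and let \<open>S[s, t]\<close> be matched to
  \<open>T[a, b]\<close> by \<open>(f, g)\<close>. Then \<open>S[s, t]\<close> has Frechet distance at most \<open>2\<Delta>\<close> from \<open>T[a, b]\<close>, which is
  within \<open>\<Delta>\<close> of \<open>P\<close>, which in turn is within \<open>\<Delta>\<close> of every \<open>T[a', b']\<close> in the family, so the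
  triangle inequality gives \<open>4\<Delta>\<close>. The triangle inequality itself rests on the fact that two
  non-decreasing surjections onto the same interval become equal after precomposing them with
  suitable non-decreasing surjections.
\<close>

section \<open>Monotone surjections\<close>

text \<open>Over any interval the increments of \<open>X\<close> and \<open>Y\<close> are
  nonnegative and add up to its length. So \<open>X\<close> is 1-Lipschitz, hence continuous, and
  the intermediate value theorem fills the image.\<close>

lemma mono_sum_id_image:
  fixes X Y :: "real \<Rightarrow> real"
  assumes "mono X" "mono Y" and sum: "\<And>r. X r + Y r = r" and "r \<le> r'"
  shows "X ` {r..r'} = {X r..X r'}"
proof -
  have "dist (X p) (X q) \<le> dist p q" for p q
  proof (cases "p \<le> q")
    case True
    then show ?thesis
      using monoD[OF \<open>mono X\<close> True] monoD[OF \<open>mono Y\<close> True] sum[of p] sum[of q]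
      by (simp add: dist_real_def)
  next
    case False
    then have "q \<le> p" by simp
    then show ?thesis
      using monoD[OF \<open>mono X\<close> \<open>q \<le> p\<close>] monoD[OF \<open>mono Y\<close> \<open>q \<le> p\<close>] sum[of p] sum[of q]
      by (simp add: dist_real_def)
  qed
  then have "continuous_on UNIV X"
    unfolding continuous_on_iff by (meson le_less_trans)
  then have cont: "continuous_on {r..r'} X"
    by (rule continuous_on_subset) simp
  show ?thesis
  proof
    show "X ` {r..r'} \<subseteq> {X r..X r'}"
      using \<open>mono X\<close> by (auto intro!: monoD[of X])
    show "{X r..X r'} \<subseteq> X ` {r..r'}"
    proof
      fix y assume "y \<in> {X r..X r'}"
      then show "y \<in> X ` {r..r'}"
        using IVT'[of X r y r', OF _ _ \<open>r \<le> r'\<close> cont] by auto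
    qed
  qed
qed

text \<open>Each antidiagonal x + y = r meets the set where F x = G y, because F x - G (r - x) is
  continuous and non-decreasing in x and changes sign. \<open>X r\<close> picks the leftmost such
  point. Using r = x + y as the parameter is what makes both coordinates monotone.\<close>

lemma mono_surj_pullback:
  fixes F G :: "real \<Rightarrow> real"
  assumes "mono F" "surj F" "mono G" "surj G"
  obtains X Y :: "real \<Rightarrow> real"
  where "mono X" "mono Y" "\<And>r. X r + Y r = r" "\<And>r. F (X r) = G (Y r)"
proof -
  have F: "continuous_on UNIV F" and G: "continuous_on UNIV G"
    using assms by (auto intro!: continuous_onI_mono monoD[of F] monoD[of G])
  define D where "D r = {x. G (r - x) \<le> F x}" for r
  define X where "X r = Inf (D r)" for r
  \<comment> \<open>These anchors locate the sign change: at or left of both \<open>x1\<close> and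
    \<open>r - y0\<close> we have F x <= -1 < 0 <= G (r - x), while at or right of both
    \<open>x0\<close> and \<open>r - y0\<close> we have G (r - x) <= 0 <= F x.\<close>
  obtain x0 x1 y0 where vals: "F x0 = 0" "F x1 = -1" "G y0 = 0"
    using assms by (metis surjD)
  have Gc: "continuous_on UNIV (\<lambda>x. G (r - x))" for r
    by (rule continuous_on_compose2[OF G]) (auto intro: continuous_intros)
  have closed: "closed (D r)" for r
    unfolding D_def by (intro closed_Collect_le Gc F)
  have low: "min x1 (r - y0) < x" if "x \<in> D r" for x r
  proof (rule ccontr)
    assume "\<not> min x1 (r - y0) < x"
    then have "F x \<le> F x1" "G y0 \<le> G (r - x)"
      using assms by (auto intro!: monoD[of F] monoD[of G])
    with that vals show False by (simp add: D_def)
  qed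
  then have bdd: "bdd_below (D r)" for r
    unfolding bdd_below_def using less_imp_le by blast
  have zero: "\<exists>z. F z = G (r - z)" for r
  proof -
    let ?p = "min x1 (r - y0)" and ?q = "max x0 (r - y0)"
    have "\<not> G (r - ?p) \<le> F ?p"
      using low[of ?p r] by (auto simp: D_def)
    moreover have "F x0 \<le> F ?q" "G (r - ?q) \<le> G y0"
      using assms by (auto intro!: monoD[of F] monoD[of G])
    ultimately have "\<exists>z\<ge>?p. z \<le> ?q \<and> F z - G (r - z) = 0"
      using vals
      by (intro IVT' continuous_on_diff continuous_on_subset[OF F] continuous_on_subset[OF Gc])
        auto
    then show ?thesis by auto
  qed
  have X_in: "X r \<in> D r" for r
    unfolding X_def using closed bdd zero[of r]
    by (intro closed_contains_Inf) (auto simp: D_def intro: eq_refl[OF sym])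
  have X_le: "X r \<le> x" if "x \<in> D r" for r x
    unfolding X_def using bdd that by (rule cInf_lower[rotated])
  \<comment> \<open>Membership in the closed set \<open>D r\<close> gives one inequality. The other
    follows by comparing with any solution z, which lies in \<open>D r\<close> and hence to the
    right of \<open>X r\<close>.\<close>
  have eq: "F (X r) = G (r - X r)" for r
  proof -
    obtain z where z: "F z = G (r - z)" using zero by blast
    then have "X r \<le> z" by (intro X_le) (simp add: D_def)
    then have "F (X r) \<le> F z" "G (r - z) \<le> G (r - X r)"
      using assms by (auto intro!: monoD[of F] monoD[of G])
    with z X_in[of r] show ?thesis by (simp add: D_def)
  qed
  show thesis
  proof (rule that[of X "\<lambda>r. r - X r"])
    \<comment> \<open>For r <= r' the set \<open>D r'\<close> is contained in \<open>D r\<close>, so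
      the infimum can only grow.\<close>
    show "mono X"
    proof (rule monoI)
      fix r r' :: real assume "r \<le> r'"
      then have "G (r - X r') \<le> G (r' - X r')"
        using assms by (auto intro!: monoD[of G])
      with X_in[of r'] show "X r \<le> X r'"
        by (intro X_le) (simp add: D_def)
    qed
    \<comment> \<open>Moving right along x by r' - r keeps y = r - X r fixed and does not decrease
      F, so the shifted point lies in \<open>D r'\<close> and bounds \<open>X r'\<close> from
      above.\<close>
    show "mono (\<lambda>r. r - X r)"
    proof (rule monoI)
      fix r r' :: real assume "r \<le> r'"
      then have "F (X r) \<le> F (X r + (r' - r))"
        using assms by (auto intro!: monoD[of F])
      with X_in[of r] have "X r' \<le> X r + (r' - r)"
        by (intro X_le) (simp add: D_def)
      then show "r - X r \<le> r' - X r'" by simp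
    qed
  qed (use eq in auto)
qed

section \<open>Reparameterizations and their common refinement\<close>

lemma reparameterization_range:
  "reparameterization n f \<Longrightarrow> t \<in> {0..1} \<Longrightarrow> f t \<in> {1..real n}"
  unfolding reparameterization_def by blast

lemma reparameterization_surj:
  assumes "reparameterization n f" "y \<in> {1..real n}"
  obtains t where "t \<in> {0..1}" "f t = y"
proof -
  have "y \<in> f ` {0..1}"
    using assms unfolding reparameterization_def by (elim conjE) (simp only:)
  then show thesis using that by (metis imageE)
qed

lemma reparameterization_mono:
  "reparameterization n f \<Longrightarrow> 0 \<le> x \<Longrightarrow> x \<le> y \<Longrightarrow> y \<le> 1 \<Longrightarrow> f x \<le> f y"
  unfolding reparameterization_def mono_on_def by auto

text \<open>A preimage outside [u, v] of a value between f u and f v is harmless: monotonicity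
  forces that value to be f u or f v itself.\<close>

lemma reparameterization_subinterval:
  assumes f: "reparameterization n f" and "0 \<le> u" "u \<le> v" "v \<le> 1"
  shows "f ` {u..v} = {f u..f v}"
proof
  show "f ` {u..v} \<subseteq> {f u..f v}"
    using reparameterization_mono[OF f] assms by auto
  show "{f u..f v} \<subseteq> f ` {u..v}"
  proof
    fix y assume y: "y \<in> {f u..f v}"
    then have "y \<in> {1..real n}"
      using reparameterization_range[OF f, of u] reparameterization_range[OF f, of v] assms by auto
    then obtain w where w: "w \<in> {0..1}" "f w = y"
      using reparameterization_surj[OF f] by metis
    consider "w < u" | "w \<in> {u..v}" | "v < w" by fastforce
    then show "y \<in> f ` {u..v}"
    proof cases
      case 1
      then have "y = f u"
        using reparameterization_mono[OF f, of w u] w y assms by auto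
      then show ?thesis using assms by auto
    next
      case 3
      then have "y = f v"
        using reparameterization_mono[OF f, of v w] w y assms by auto
      then show ?thesis using assms by auto
    qed (use w in auto)
  qed
qed

text \<open>
  The slope 1 outside \<open>[0, 1]\<close> makes continuity automatic (monotone with open range) and rules out
  solutions of \<open>F x = G y\<close> with exactly one coordinate outside \<open>[0, 1]\<close>.
\<close>

lemma reparameterization_extend:
  assumes f: "reparameterization n f"
  obtains F :: "real \<Rightarrow> real"
  where "mono F" "surj F" "\<And>x. x \<in> {0..1} \<Longrightarrow> F x = f x"
    "\<And>x. x < 0 \<Longrightarrow> F x = 1 + x" "\<And>x. x > 1 \<Longrightarrow> F x = real n + (x - 1)"
proof -
  define F where "F x = (if x < 0 then 1 + x else if x > 1 then real n + (x - 1) else f x)" for x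
  have r: "1 \<le> f x \<and> f x \<le> real n" if "0 \<le> x" "x \<le> 1" for x
    using reparameterization_range[OF f, of x] that by auto
  have n: "1 \<le> real n" using r[of 0] by auto
  have "mono F"
  proof (rule monoI)
    fix x y :: real assume "x \<le> y"
    then show "F x \<le> F y"
      using r[of x] r[of y] n reparameterization_mono[OF f, of x y] unfolding F_def by auto
  qed
  moreover have "surj F"
  proof -
    have "\<exists>x. F x = y" for y
    proof -
      consider "y < 1" | "y \<in> {1..real n}" | "y > real n" by fastforce
      then show ?thesis
      proof cases
        case 1
        then show ?thesis by (intro exI[of _ "y - 1"]) (simp add: F_def)
      next
        case 2
        then obtain x where "x \<in> {0..1}" "f x = y"
          using reparameterization_surj[OF f] by metis
        then show ?thesis by (intro exI[of _ x]) (simp add: F_def)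
      next
        case 3
        then show ?thesis by (intro exI[of _ "y - real n + 1"]) (simp add: F_def)
      qed
    qed
    then show ?thesis by (metis surjI surj_def)
  qed
  ultimately show thesis
    by (rule that) (auto simp: F_def)
qed

text \<open>The pullback is taken for the extensions to the whole line and then restricted to r in
  [0, 2], where both coordinates turn out to run exactly through [0, 1]. Doubling the parameter
  brings the domain back to [0, 1].\<close>

lemma reparameterization_pullback:
  assumes f: "reparameterization n f" and g: "reparameterization n g"
  obtains h k :: "real \<Rightarrow> real"
  where "mono_on {0..1} h" "h ` {0..1} = {0..1}" "mono_on {0..1} k" "k ` {0..1} = {0..1}"
    "\<And>t. t \<in> {0..1} \<Longrightarrow> f (h t) = g (k t)"
proof -
  obtain F where F: "mono F" "surj F" "\<And>x. x \<in> {0..1} \<Longrightarrow> F x = f x"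
    "\<And>x. x < 0 \<Longrightarrow> F x = 1 + x" "\<And>x. x > 1 \<Longrightarrow> F x = real n + (x - 1)"
    using reparameterization_extend[OF f] by blast
  obtain G where G: "mono G" "surj G" "\<And>x. x \<in> {0..1} \<Longrightarrow> G x = g x"
    "\<And>x. x < 0 \<Longrightarrow> G x = 1 + x" "\<And>x. x > 1 \<Longrightarrow> G x = real n + (x - 1)"
    using reparameterization_extend[OF g] by blast
  obtain X Y where XY: "mono X" "mono Y" "\<And>r. X r + Y r = r" "\<And>r. F (X r) = G (Y r)"
    using mono_surj_pullback[OF F(1,2) G(1,2)] by blast
  have n: "1 \<le> real n"
    using reparameterization_range[OF f, of 0] by auto
  \<comment> \<open>The values of the extension reveal on which side of [0, 1] the argument lies, so
    F (X r) = G (Y r) puts \<open>X r\<close> and \<open>Y r\<close> on the same side.\<close>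
  have F0: "F x < 1 \<longleftrightarrow> x < 0" "F x > real n \<longleftrightarrow> x > 1" for x
    using F(3-5)[of x] reparameterization_range[OF f, of x] n
    by (cases "x < 0"; cases "x > 1"; simp)+
  have G0: "G x < 1 \<longleftrightarrow> x < 0" "G x > real n \<longleftrightarrow> x > 1" for x
    using G(3-5)[of x] reparameterization_range[OF g, of x] n
    by (cases "x < 0"; cases "x > 1"; simp)+
  have iff: "X r < 0 \<longleftrightarrow> Y r < 0" "X r > 1 \<longleftrightarrow> Y r > 1" for r
    using F0[of "X r"] G0[of "Y r"] XY(4)[of r] by auto
  \<comment> \<open>If both coordinates were negative, their sum r would be negative; if both
    exceeded 1, r would exceed 2. At r = 0 and r = 2 the same sum pins down both
    coordinates.\<close>
  have range: "X r \<in> {0..1}" "Y r \<in> {0..1}" if "r \<in> {0..2}" for r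
    using iff[of r] XY(3)[of r] that by auto
  have ends: "X 0 = 0" "Y 0 = 0" "X 2 = 1" "Y 2 = 1"
    using range[of 0] range[of 2] XY(3)[of 0] XY(3)[of 2] by auto
  have XI: "X ` {0..2} = {0..1}"
    using mono_sum_id_image[OF XY(1,2,3), of 0 2] ends by simp
  have YI: "Y ` {0..2} = {0..1}"
    using mono_sum_id_image[OF XY(2,1), of 0 2] XY(3) ends by (simp add: add.commute)
  have dbl: "(\<lambda>t. 2 * t) ` {0..1} = {0..2::real}"
    using image_mult_atLeastAtMost[of 2 0 "1::real"] by simp
  show thesis
  proof (rule that[of "\<lambda>t. X (2 * t)" "\<lambda>t. Y (2 * t)"])
    show "mono_on {0..1} (\<lambda>t. X (2 * t))" "mono_on {0..1} (\<lambda>t. Y (2 * t))"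
      using XY(1,2) by (auto intro!: mono_onI monoD[of X] monoD[of Y])
    show "(\<lambda>t. X (2 * t)) ` {0..1} = {0..1}" "(\<lambda>t. Y (2 * t)) ` {0..1} = {0..1}"
      by (simp_all only: image_image[symmetric, of X "\<lambda>t. 2 * t"]
          image_image[symmetric, of Y "\<lambda>t. 2 * t"] dbl XI YI)
    fix t :: real assume "t \<in> {0..1}"
    then have "2 * t \<in> {0..2}" by simp
    then show "f (X (2 * t)) = g (Y (2 * t))"
      using range[of "2 * t"] F(3) G(3) XY(4)[of "2 * t"] by metis
  qed
qed

lemma reparameterization_comp:
  assumes "reparameterization n f" "mono_on {0..1} h" "h ` {0..1} = {0..1}"
  shows "reparameterization n (\<lambda>t. f (h t))"
  unfolding reparameterization_def
proof
  show "mono_on {0..1} (\<lambda>t. f (h t))"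
  proof (rule mono_onI)
    fix r s :: real assume rs: "r \<in> {0..1}" "s \<in> {0..1}" "r \<le> s"
    then have "h r \<in> {0..1}" "h s \<in> {0..1}"
      using assms(3) imageI[of r "{0..1}" h] imageI[of s "{0..1}" h] by simp_all
    moreover have "h r \<le> h s"
      using mono_onD[OF assms(2) rs] .
    ultimately show "f (h r) \<le> f (h s)"
      using reparameterization_mono[OF assms(1)] by auto
  qed
  show "(\<lambda>t. f (h t)) ` {0..1} = {1..real n}"
    using assms(1,3) image_image[of f h "{0..1}"] by (simp add: reparameterization_def)
qed

lemma ex_reparameterization:
  assumes "n \<ge> 1"
  shows "\<exists>f. reparameterization n f"
proof -
  have "mono_on {0..1} (\<lambda>t. (real n - 1) * t + 1)"
    using assms by (auto intro!: mono_onI mult_left_mono)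
  moreover have "(\<lambda>t. (real n - 1) * t + 1) ` {0..1} = {1..real n}"
    using assms image_affinity_atLeastAtMost[of "real n - 1" 1 0 1] by simp
  ultimately show ?thesis
    unfolding reparameterization_def by (intro exI conjI)
qed

section \<open>The Frechet distance\<close>

lemma is_curve_segment:
  assumes "is_curve P" "1 \<le> m" "m < complexity P" "real m \<le> x" "x \<le> real m + 1"
  shows "point P x = (1 - (x - real m)) *\<^sub>R point P (real m) + (x - real m) *\<^sub>R point P (real m + 1)"
proof -
  have "point P (real m + (x - real m)) =
      (1 - (x - real m)) *\<^sub>R point P (real m) + (x - real m) *\<^sub>R point P (real (m + 1))"
    using assms(1)[unfolded is_curve_def, THEN conjunct2, rule_format, of m "x - real m"] assms(2-)
    by simp
  then show ?thesis by (simp add: add.commute)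
qed

text \<open>Every point is a convex combination of two vertices, so the sum of all vertex norms is a
  crude bound. It makes the supremum in \<open>matching_cost\<close> range over a bounded
  set.\<close>

lemma is_curve_bounded:
  assumes P: "is_curve P"
  shows "\<exists>B. \<forall>x\<in>{1..real (complexity P)}. norm (point P x) \<le> B"
proof -
  let ?n = "complexity P"
  define B where "B = (\<Sum>i\<le>?n. norm (point P (real i)))"
  have v: "norm (point P (real i)) \<le> B" if "i \<le> ?n" for i
    unfolding B_def using that by (intro member_le_sum) auto
  have "norm (point P x) \<le> B" if x: "1 \<le> x" "x \<le> real ?n" for x
  \<comment> \<open>The last vertex is treated apart, since no segment starts at its floor.\<close>
  proof (cases "x = real ?n")
    case True
    then show ?thesis using v by simp
  next
    case False
    define m where "m = nat \<lfloor>x\<rfloor>"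
    have m: "1 \<le> m" "m < ?n" "real m \<le> x" "x \<le> real m + 1"
      using x False unfolding m_def by linarith+
    have "norm (point P x) \<le>
        (1 - (x - real m)) * norm (point P (real m)) + (x - real m) * norm (point P (real m + 1))"
      unfolding is_curve_segment[OF P m]
      using m by (intro norm_triangle_le) simp
    also have "\<dots> \<le> (1 - (x - real m)) * B + (x - real m) * B"
      using m v[of m] v[of "m + 1"] by (intro add_mono mult_left_mono) (auto simp: add.commute)
    finally show ?thesis by (simp add: algebra_simps)
  qed
  then show ?thesis by (intro exI[of _ B] ballI) auto
qed

text \<open>A real \<open>SUP\<close> is an upper bound only for a set bounded above; boundedness of
  both curves supplies this.\<close>

lemma norm_le_matching_cost:
  assumes P: "is_curve P" and Q: "is_curve Q" and m: "matching P Q f g" and t: "t \<in> {0..1}"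
  shows "norm (point P (f t) - point Q (g t)) \<le> matching_cost P Q f g"
proof -
  obtain B C where B: "\<forall>x\<in>{1..real (complexity P)}. norm (point P x) \<le> B"
    and C: "\<forall>x\<in>{1..real (complexity Q)}. norm (point Q x) \<le> C"
    using is_curve_bounded P Q by meson
  have "norm (point P (f t) - point Q (g t)) \<le> B + C" if "t \<in> {0..1}" for t
  proof -
    have "f t \<in> {1..real (complexity P)}" "g t \<in> {1..real (complexity Q)}"
      using m that reparameterization_range unfolding matching_def by metis+
    then have "norm (point P (f t)) \<le> B" "norm (point Q (g t)) \<le> C"
      using B C by metis+
    then show ?thesis
      by (intro order_trans[OF norm_triangle_ineq4] add_mono)
  qed
  then have "bdd_above ((\<lambda>t. norm (point P (f t) - point Q (g t))) ` {0..1})"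
    by (rule bdd_aboveI2)
  then show ?thesis
    unfolding matching_cost_def using t by (rule cSUP_upper2) simp
qed

lemma frechet_dist_leI:
  assumes P: "is_curve P" and Q: "is_curve Q" and m: "matching P Q f g"
    and le: "\<And>t. t \<in> {0..1} \<Longrightarrow> norm (point P (f t) - point Q (g t)) \<le> c"
  shows "frechet_dist P Q \<le> c"
proof -
  have "0 \<le> matching_cost P Q f' g'" if "matching P Q f' g'" for f' g'
    by (rule order_trans[OF norm_ge_zero norm_le_matching_cost[OF P Q that, of 0]]) simp
  then have "bdd_below {matching_cost P Q f g | f g. matching P Q f g}"
    by (intro bdd_belowI[of _ 0]) blast
  then have "frechet_dist P Q \<le> matching_cost P Q f g"
    unfolding frechet_dist_def using m by (intro cInf_lower) auto
  also have "\<dots> \<le> c"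
    unfolding matching_cost_def using le by (intro cSUP_least) auto
  finally show ?thesis .
qed

text \<open>The strict inequality yields a matching directly from the infimum, so no attainment
  argument (compactness of matchings) enters.\<close>

lemma frechet_dist_lessE:
  assumes P: "is_curve P" and Q: "is_curve Q" and "frechet_dist P Q < c"
  obtains f g where "matching P Q f g"
    "\<And>t. t \<in> {0..1} \<Longrightarrow> norm (point P (f t) - point Q (g t)) \<le> c"
proof -
  \<comment> \<open>Some matching exists, so the infimum is not that of the empty set, whose value
    is unspecified.\<close>
  have "complexity P \<ge> 1" "complexity Q \<ge> 1"
    using P Q by (simp_all add: is_curve_def)
  then obtain f\<^sub>0 g\<^sub>0 where "matching P Q f\<^sub>0 g\<^sub>0"
    using ex_reparameterization unfolding matching_def by metis
  then have "{matching_cost P Q f g | f g. matching P Q f g} \<noteq> {}" by blast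
  from cInf_lessD[OF this assms(3)[unfolded frechet_dist_def]]
  obtain f g where m: "matching P Q f g" and lt: "matching_cost P Q f g < c"
    by blast
  show thesis
  proof (rule that[OF m])
    fix t :: real assume "t \<in> {0..1}"
    then show "norm (point P (f t) - point Q (g t)) \<le> c"
      using norm_le_matching_cost[OF P Q m, of t] lt by linarith
  qed
qed

lemma frechet_dist_sym: "frechet_dist P Q = frechet_dist Q P"
proof -
  have "matching P Q f g \<longleftrightarrow> matching Q P g f" for f g
    unfolding matching_def by blast
  moreover have "matching_cost P Q f g = matching_cost Q P g f" for f g
    unfolding matching_cost_def by (simp add: norm_minus_commute)
  ultimately have "{matching_cost P Q f g | f g. matching P Q f g} =
      {matching_cost Q P f g | f g. matching Q P f g}"
    by (simp only:) blast
  then show ?thesis unfolding frechet_dist_def by simp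
qed

text \<open>Near-optimal matchings of P with Q and of Q with R are brought to a common traversal of
  Q by the pullback, and the pointwise norms add up. The slack e / 2 on each side replaces optimal
  matchings.\<close>

lemma frechet_dist_triangle:
  assumes P: "is_curve P" and Q: "is_curve Q" and R: "is_curve R"
  shows "frechet_dist P R \<le> frechet_dist P Q + frechet_dist Q R"
proof (rule field_le_epsilon)
  fix e :: real assume "0 < e"
  then have lt: "frechet_dist P Q < frechet_dist P Q + e / 2"
    "frechet_dist Q R < frechet_dist Q R + e / 2"
    by auto
  obtain f g where fg: "matching P Q f g"
    "\<And>t. t \<in> {0..1} \<Longrightarrow> norm (point P (f t) - point Q (g t)) \<le> frechet_dist P Q + e / 2"
    using frechet_dist_lessE[OF P Q lt(1)] by blast
  obtain f' g' where fg': "matching Q R f' g'"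
    "\<And>t. t \<in> {0..1} \<Longrightarrow> norm (point Q (f' t) - point R (g' t)) \<le> frechet_dist Q R + e / 2"
    using frechet_dist_lessE[OF Q R lt(2)] by blast
  have "reparameterization (complexity Q) g" "reparameterization (complexity Q) f'"
    using fg(1) fg'(1) unfolding matching_def by auto
  then obtain h k :: "real \<Rightarrow> real" where
    hk: "mono_on {0..1} h" "h ` {0..1} = {0..1}" "mono_on {0..1} k" "k ` {0..1} = {0..1}"
    and eq: "\<And>t. t \<in> {0..1} \<Longrightarrow> g (h t) = f' (k t)"
    using reparameterization_pullback by blast
  show "frechet_dist P R \<le> frechet_dist P Q + frechet_dist Q R + e"
  proof (rule frechet_dist_leI[OF P R])
    show "matching P R (\<lambda>t. f (h t)) (\<lambda>t. g' (k t))"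
      using fg(1) fg'(1) hk reparameterization_comp unfolding matching_def by blast
    fix t :: real assume t: "t \<in> {0..1}"
    then have "h t \<in> {0..1}" "k t \<in> {0..1}" 
      using hk(2,4) imageI[of t "{0..1}" h] imageI[of t "{0..1}" k] by simp_all
    then have "norm ((point P (f (h t)) - point Q (g (h t))) + (point Q (f' (k t)) - point R (g' (k t))))
        \<le> (frechet_dist P Q + e / 2) + (frechet_dist Q R + e / 2)"
      using fg(2) fg'(2) by (intro norm_triangle_le add_mono)
    then show "norm (point P (f (h t)) - point R (g' (k t))) \<le> frechet_dist P Q + frechet_dist Q R + e"
      using eq[OF t] by simp
  qed
qed

section \<open>Subcurves\<close>

lemma interpolate_of_nat: "interpolate v (real i) = v i"
  by (simp add: interpolate_def frac_def)

lemma interpolate_affine: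
  assumes "0 \<le> u" "u \<le> 1"
  shows "interpolate v (real i + u) = (1 - u) * v i + u * v (i + 1)"
\<comment> \<open>At u = 1 the floor jumps to i + 1 and the fractional part drops to 0, so the
  defining formula reads off different vertices.\<close>
proof (cases "u = 1")
  case True
  then have "real i + u = real (i + 1)" by simp
  then show ?thesis using True by (simp only: interpolate_of_nat) simp
next
  case False
  then have "\<lfloor>real i + u\<rfloor> = int i" using assms by linarith
  then show ?thesis by (simp add: interpolate_def frac_def)
qed

text \<open>Within one unit cell the slope is positive. Across cells the value
  \<open>v (i + 1)\<close> separates: it is strictly above the interpolation at x and not above the
  one at y.\<close>

lemma interpolate_strict_mono:
  assumes v: "strict_mono_on {1..k} v"
  shows "strict_mono_on {1..real k} (interpolate v)"
proof (rule strict_mono_onI)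
  fix x y assume xy: "x \<in> {1..real k}" "y \<in> {1..real k}" "x < y"
  define i p j q where "i = nat \<lfloor>x\<rfloor>" "p = frac x" "j = nat \<lfloor>y\<rfloor>" "q = frac y"
  have x: "x = real i + p" "0 \<le> p" "p < 1" "1 \<le> i"
    using xy unfolding i_p_j_q_def frac_def atLeastAtMost_iff by linarith+
  \<comment> \<open>The last disjunction covers y = k: there \<open>v (j + 1)\<close> is outside the
    range of monotonicity, but its weight q vanishes.\<close>
  have y: "y = real j + q" "0 \<le> q" "q < 1" "1 \<le> j" "j \<le> k" "q = 0 \<or> j < k"
    using xy unfolding i_p_j_q_def frac_def atLeastAtMost_iff by linarith+
  have ix: "interpolate v x = v i + p * (v (i + 1) - v i)"
    using interpolate_affine[of p v i] x by (simp add: algebra_simps)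
  have iy: "interpolate v y = v j + q * (v (j + 1) - v j)"
    using interpolate_affine[of q v j] y by (simp add: algebra_simps)
  have vy: "q * (v (j + 1) - v j) \<ge> 0"
    using y strict_mono_onD[OF v, of j "j + 1"] by auto
  have "i \<le> j" using x y xy by linarith
  show "interpolate v x < interpolate v y"
  proof (cases "i = j")
    case True
    then have "p < q" using x y xy by simp
    then have "v i < v (i + 1)"
      using x y True strict_mono_onD[OF v, of i "i + 1"] by auto
    then show ?thesis using ix iy True \<open>p < q\<close> by simp
  next
    case False
    then have "i + 1 \<le> j" using \<open>i \<le> j\<close> by simp
    then have "v i < v (i + 1)" "v (i + 1) \<le> v j"
      using x y strict_mono_onD[OF v, of i "i + 1"] strict_mono_onD[OF v, of "i + 1" j]
      by (cases "i + 1 = j"; auto)+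
    define d where "d = v (i + 1) - v i"
    have "p * d < d"
      using \<open>v i < v (i + 1)\<close> x by (simp add: d_def)
    then have "interpolate v x < v i + d" unfolding ix d_def[symmetric] by simp
    also have "v i + d \<le> v j" using \<open>v (i + 1) \<le> v j\<close> by (simp add: d_def)
    also have "v j \<le> interpolate v y" unfolding iy using vy by simp
    finally show ?thesis .
  qed
qed

text \<open>For surjectivity, take the last vertex not above y and solve the affine equation on the
  cell that starts there.\<close>

lemma interpolate_image:
  assumes v: "strict_mono_on {1..k} v" and "1 \<le> k"
  shows "interpolate v ` {1..real k} = {v 1..v k}"
proof
  have "interpolate v x \<in> {v 1..v k}" if x: "x \<in> {1..real k}" for x
    using strict_mono_on_leD[OF interpolate_strict_mono[OF v], of 1 x]
      strict_mono_on_leD[OF interpolate_strict_mono[OF v], of x "real k"]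
      interpolate_of_nat[of v 1] interpolate_of_nat[of v k] x by auto
  then show "interpolate v ` {1..real k} \<subseteq> {v 1..v k}" by blast
  show "{v 1..v k} \<subseteq> interpolate v ` {1..real k}"
  proof
    fix y assume y: "y \<in> {v 1..v k}"
    show "y \<in> interpolate v ` {1..real k}"
    proof (cases "y = v k")
      case True
      then have "y = interpolate v (real k)" by (simp add: interpolate_of_nat)
      then show ?thesis using \<open>1 \<le> k\<close> by auto
    next
      case False
      define i where "i = Max {i \<in> {1..k}. v i \<le> y}"
      have fin: "finite {i \<in> {1..k}. v i \<le> y}" by simp
      have "i \<in> {i \<in> {1..k}. v i \<le> y}"
        unfolding i_def using y \<open>1 \<le> k\<close> by (intro Max_in) auto
      then have i: "1 \<le> i" "i < k" "v i \<le> y"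
        using False y by (auto simp: le_less)
      have yi: "y < v (i + 1)"
      proof (rule ccontr)
        assume "\<not> y < v (i + 1)"
        then have "i + 1 \<in> {i \<in> {1..k}. v i \<le> y}" using i by auto
        then have "i + 1 \<le> i" unfolding i_def using fin by (rule Max_ge[rotated])
        then show False by simp
      qed
      define u where "u = (y - v i) / (v (i + 1) - v i)"
      have u: "0 \<le> u" "u \<le> 1" "u * (v (i + 1) - v i) = y - v i"
        using i yi by (auto simp: u_def)
      have "interpolate v (real i + u) = v i + u * (v (i + 1) - v i)"
        unfolding interpolate_affine[OF u(1,2)] by (simp only: algebra_simps)
      also have "\<dots> = y" unfolding u(3) by simp
      finally have "interpolate v (real i + u) = y" .
      moreover have "real i + u \<in> {1..real k}" using i u by auto
      ultimately show ?thesis by blast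
    qed
  qed
qed

section \<open>The vertices of a subcurve\<close>

lemma finite_subcurve_params: "finite (subcurve_params a b)"
proof -
  \<comment> \<open>On an infinite set \<open>card\<close> and \<open>sorted_list_of_set\<close>
    return default values, so this bound is what gives the encoding of subcurves its
    meaning.\<close>
  have "\<nat> \<inter> {a<..<b} \<subseteq> real ` {..nat \<lceil>b\<rceil>}"
    by (auto elim!: Nats_cases intro!: imageI) linarith
  then show ?thesis
    unfolding subcurve_params_def using finite_subset by auto
qed

text \<open>Vertices are numbered from 1, while list positions start at 0.\<close>

definition subcurve_vertex :: "real \<Rightarrow> real \<Rightarrow> nat \<Rightarrow> real" where
  "subcurve_vertex a b j = sorted_list_of_set (subcurve_params a b) ! (j - 1)"

lemma complexity_subcurve: "complexity (subcurve P a b) = card (subcurve_params a b)"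
  by (simp add: subcurve_def)

lemma point_subcurve: "point (subcurve P a b) x = point P (interpolate (subcurve_vertex a b) x)"
  by (simp add: subcurve_def subcurve_vertex_def[abs_def])

lemma card_subcurve_params_ge_1: "card (subcurve_params a b) \<ge> 1"
  using finite_subcurve_params[of a b] by (simp add: Suc_le_eq card_gt_0_iff subcurve_params_def)

lemma subcurve_vertex_image:
  "subcurve_vertex a b ` {1..card (subcurve_params a b)} = subcurve_params a b"
proof -
  let ?A = "subcurve_params a b"
  let ?xs = "sorted_list_of_set ?A"
  have "?A = set ?xs" by (simp add: finite_subcurve_params)
  also have "\<dots> = (\<lambda>j. ?xs ! j) ` {0..<card ?A}"
    by (auto simp: set_conv_nth)
  also have "\<dots> = (\<lambda>j. ?xs ! (j - 1)) ` Suc ` {0..<card ?A}"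
    unfolding image_image by simp
  also have "Suc ` {0..<card ?A} = {1..card ?A}"
    unfolding image_Suc_atLeastLessThan by (simp add: atLeastLessThanSuc_atLeastAtMost)
  finally show ?thesis unfolding subcurve_vertex_def by simp
qed

lemma subcurve_vertex_mem:
  "1 \<le> j \<Longrightarrow> j \<le> card (subcurve_params a b) \<Longrightarrow> subcurve_vertex a b j \<in> subcurve_params a b"
  by (rule subsetD[OF eq_refl[OF subcurve_vertex_image] imageI]) simp

lemma subcurve_vertexE:
  assumes "x \<in> subcurve_params a b"
  obtains j where "1 \<le> j" "j \<le> card (subcurve_params a b)" "subcurve_vertex a b j = x"
proof -
  have "x \<in> subcurve_vertex a b ` {1..card (subcurve_params a b)}"
    using assms by (simp only: subcurve_vertex_image)
  then show thesis using that by (elim imageE) auto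
qed

lemma subcurve_vertex_strict_mono:
  "strict_mono_on {1..card (subcurve_params a b)} (subcurve_vertex a b)"
proof (rule strict_mono_onI)
  fix i j assume ij: "i \<in> {1..card (subcurve_params a b)}" "j \<in> {1..card (subcurve_params a b)}" "i < j"
  then show "subcurve_vertex a b i < subcurve_vertex a b j"
    unfolding subcurve_vertex_def
    by (intro sorted_wrt_nth_less[OF strict_sorted_list_of_set]) auto
qed

text \<open>Both a and b occur among the vertices, all vertices lie in [a, b], and the enumeration
  is increasing.\<close>

lemma subcurve_vertex_ends:
  assumes "a \<le> b"
  shows "subcurve_vertex a b 1 = a" "subcurve_vertex a b (card (subcurve_params a b)) = b"
proof -
  let ?k = "card (subcurve_params a b)" and ?v = "subcurve_vertex a b"
  have k: "1 \<le> ?k" by (rule card_subcurve_params_ge_1)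
  have le: "?v i \<le> ?v j" if "1 \<le> i" "i \<le> j" "j \<le> ?k" for i j
    using strict_mono_on_leD[OF subcurve_vertex_strict_mono[of a b], of i j] that by auto
  have in_ab: "?v i \<in> {a..b}" if "1 \<le> i" "i \<le> ?k" for i
    using subcurve_vertex_mem[OF that] assms by (auto simp: subcurve_params_def)
  have "a \<in> subcurve_params a b" "b \<in> subcurve_params a b"
    by (simp_all add: subcurve_params_def)
  then obtain i j where i: "1 \<le> i" "i \<le> ?k" "?v i = a" and j: "1 \<le> j" "j \<le> ?k" "?v j = b"
    by (elim subcurve_vertexE)
  show "?v 1 = a" using le[of 1 i] in_ab[of 1] i k by auto
  show "?v ?k = b" using le[of j ?k] in_ab[of ?k] j k by auto
qed

text \<open>A natural number strictly between consecutive vertices would lie in (a, b), hence be a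
  vertex itself with an index strictly between i and i + 1.\<close>

lemma no_Nats_between_subcurve_vertices:
  assumes "a \<le> b" "1 \<le> i" "i < card (subcurve_params a b)"
    and "subcurve_vertex a b i < real m"
  shows "subcurve_vertex a b (i + 1) \<le> real m"
proof (rule ccontr)
  let ?k = "card (subcurve_params a b)" and ?v = "subcurve_vertex a b"
  assume "\<not> ?v (i + 1) \<le> real m"
  then have less: "?v i < real m" "real m < ?v (i + 1)" using assms by auto
  note le = strict_mono_on_leD[OF subcurve_vertex_strict_mono[of a b]]
  have "a \<le> ?v i" "?v (i + 1) \<le> b"
    using le[of 1 i] le[of "i + 1" ?k] assms subcurve_vertex_ends[OF \<open>a \<le> b\<close>] by auto
  then have "real m \<in> subcurve_params a b"
    using less by (auto simp: subcurve_params_def)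
  then obtain j where j: "1 \<le> j" "j \<le> ?k" "?v j = real m"
    by (rule subcurve_vertexE)
  then show False
    using le[of j i] le[of "i + 1" j] less assms by (cases "j \<le> i") auto
qed

text \<open>Consecutive vertices of the subcurve lie on a single segment of \<open>P\<close>, where
  \<open>P\<close> is affine in its parameter and so respects the convex combinations formed by
  \<open>interpolate\<close>.\<close>

lemma is_curve_subcurve:
  assumes P: "is_curve P" and range: "subcurve_range P a b"
  shows "is_curve (subcurve P a b)"
  unfolding is_curve_def complexity_subcurve point_subcurve
proof (intro conjI allI impI)
  let ?k = "card (subcurve_params a b)" and ?v = "subcurve_vertex a b"
  show "1 \<le> ?k" by (rule card_subcurve_params_ge_1)
  fix i :: nat and u :: real assume iu: "1 \<le> i \<and> i < ?k \<and> 0 \<le> u \<and> u \<le> 1"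
  have ab: "1 \<le> a" "a \<le> b" "b \<le> real (complexity P)"
    using range unfolding subcurve_range_def by auto
  note le = strict_mono_on_leD[OF subcurve_vertex_strict_mono[of a b]]
  have v: "a \<le> ?v i" "?v i < ?v (i + 1)" "?v (i + 1) \<le> b"
    using le[of 1 i] le[of "i + 1" ?k] iu subcurve_vertex_ends[OF ab(2)]
      strict_mono_onD[OF subcurve_vertex_strict_mono[of a b], of i "i + 1"] by auto
  \<comment> \<open>The segment starting at m contains both vertices. It exists because
    \<open>?v i\<close> is strictly below \<open>?v (i + 1)\<close>, which is at most
    \<open>complexity P\<close>; and m + 1 is a natural number above \<open>?v i\<close>, so
    \<open>?v (i + 1)\<close> cannot pass it.\<close>
  define m where "m = nat \<lfloor>?v i\<rfloor>"
  have m: "1 \<le> m" "m < complexity P" "real m \<le> ?v i" "?v i < real m + 1"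
    using v ab unfolding m_def by linarith+
  have m1: "?v (i + 1) \<le> real m + 1"
    using no_Nats_between_subcurve_vertices[OF ab(2), of i "m + 1"] iu m by (simp add: add.commute)
  have seg: "point P x = point P (real m) + (x - real m) *\<^sub>R (point P (real m + 1) - point P (real m))"
    if "real m \<le> x" "x \<le> real m + 1" for x
    using is_curve_segment[OF P m(1,2) that] by (simp add: algebra_simps)
  define x where "x = (1 - u) * ?v i + u * ?v (i + 1)"
  have "interpolate ?v (real i + u) = x"
    unfolding x_def using iu by (intro interpolate_affine) auto
  moreover have "?v i \<le> x" "x \<le> ?v (i + 1)"
  proof -
    have "x = ?v i + u * (?v (i + 1) - ?v i)" "x = ?v (i + 1) - (1 - u) * (?v (i + 1) - ?v i)"
      by (simp_all add: x_def algebra_simps)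
    moreover have "0 \<le> u * (?v (i + 1) - ?v i)" "0 \<le> (1 - u) * (?v (i + 1) - ?v i)"
      using iu v by auto
    ultimately show "?v i \<le> x" "x \<le> ?v (i + 1)" by linarith+
  qed
  ultimately have X: "interpolate ?v (real i + u) = x" "real m \<le> x" "x \<le> real m + 1"
    using m m1 by linarith+
  define A D where "A = point P (real m)" "D = point P (real m + 1) - point P (real m)"
  have pts: "point P x = A + (x - real m) *\<^sub>R D"
    "point P (?v i) = A + (?v i - real m) *\<^sub>R D"
    "point P (?v (i + 1)) = A + (?v (i + 1) - real m) *\<^sub>R D"
    unfolding A_D_def using m m1 v(2) X by (intro seg; linarith)+
  have coeff: "x - real m = (1 - u) * (?v i - real m) + u * (?v (i + 1) - real m)"
    unfolding x_def by (simp add: algebra_simps)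
  have "point P x = (1 - u) *\<^sub>R point P (?v i) + u *\<^sub>R point P (?v (i + 1))"
    unfolding pts coeff by (simp add: algebra_simps)
  then show "point P (interpolate ?v (real i + u)) =
      (1 - u) *\<^sub>R point P (interpolate ?v (real i)) + u *\<^sub>R point P (interpolate ?v (real (i + 1)))"
    unfolding interpolate_of_nat X(1) .
qed

text \<open>This inverse turns a parameter of the original curve into the parameter of the same
  point on the subcurve. A matching of the subcurve must run through the latter.\<close>

definition subcurve_position :: "real \<Rightarrow> real \<Rightarrow> real \<Rightarrow> real" where
  "subcurve_position a b =
     inv_into {1..real (card (subcurve_params a b))} (interpolate (subcurve_vertex a b))"

lemma interpolate_subcurve_vertex_image:
  assumes "a \<le> b"
  shows "interpolate (subcurve_vertex a b) ` {1..real (card (subcurve_params a b))} = {a..b}"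
  using interpolate_image[OF subcurve_vertex_strict_mono[of a b] card_subcurve_params_ge_1[of a b]]
  unfolding subcurve_vertex_ends[OF assms] .

lemma interpolate_subcurve_position:
  assumes "a \<le> b" "x \<in> {a..b}"
  shows "interpolate (subcurve_vertex a b) (subcurve_position a b x) = x"
  unfolding subcurve_position_def
  by (rule f_inv_into_f) (simp only: interpolate_subcurve_vertex_image assms)

lemma point_subcurve_position:
  assumes "a \<le> b" "x \<in> {a..b}"
  shows "point (subcurve P a b) (subcurve_position a b x) = point P x"
  unfolding point_subcurve interpolate_subcurve_position[OF assms] ..

lemma subcurve_position_image:
  assumes "a \<le> b"
  shows "subcurve_position a b ` {a..b} = {1..real (card (subcurve_params a b))}"
proof -
  have "inj_on (interpolate (subcurve_vertex a b)) {1..real (card (subcurve_params a b))}"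
    by (rule strict_mono_on_imp_inj_on[OF interpolate_strict_mono[OF subcurve_vertex_strict_mono]])
  from inv_into_image_cancel[OF this subset_refl] show ?thesis
    unfolding interpolate_subcurve_vertex_image[OF assms] subcurve_position_def .
qed

lemma subcurve_position_mono:
  assumes "a \<le> b"
  shows "mono_on {a..b} (subcurve_position a b)"
proof (rule mono_onI)
  let ?\<psi> = "subcurve_position a b" and ?\<phi> = "interpolate (subcurve_vertex a b)"
  fix x y assume xy: "x \<in> {a..b}" "y \<in> {a..b}" "x \<le> y"
  show "?\<psi> x \<le> ?\<psi> y"
  proof (rule ccontr)
    assume "\<not> ?\<psi> x \<le> ?\<psi> y"
    then have "?\<psi> y < ?\<psi> x" by simp
    moreover have "?\<psi> x \<in> {1..real (card (subcurve_params a b))}"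
      "?\<psi> y \<in> {1..real (card (subcurve_params a b))}"
      using imageI[of _ "{a..b}" ?\<psi>] xy(1,2) unfolding subcurve_position_image[OF assms] by metis+
    ultimately have "?\<phi> (?\<psi> y) < ?\<phi> (?\<psi> x)"
      by (intro strict_mono_onD[OF interpolate_strict_mono[OF subcurve_vertex_strict_mono]])
    then show False
      using interpolate_subcurve_position[OF assms] xy by simp
  qed
qed

section \<open>Restricting a matching to subcurves\<close>

lemma reparameterization_restrict:
  assumes f: "reparameterization n f" and uv: "0 \<le> u" "u \<le> v" "v \<le> 1"
    and \<psi>: "mono_on {f u..f v} \<psi>" "\<psi> ` {f u..f v} = {1..real k}"
  shows "reparameterization k (\<lambda>r. \<psi> (f (u + r * (v - u))))"
  unfolding reparameterization_def
proof
  \<comment> \<open>Time [0, 1] is rescaled onto [u, v]; for u = v the map is constant and the image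
    is the single point u.\<close>
  have aff: "(\<lambda>r. u + r * (v - u)) ` {0..1} = {u..v}"
    using image_affinity_atLeastAtMost[of "v - u" u 0 1] uv by (simp add: add.commute mult.commute)
  then have "(\<lambda>r. \<psi> (f (u + r * (v - u)))) ` {0..1} = \<psi> ` f ` {u..v}"
    by (metis (no_types, lifting) image_cong image_image)
  then show "(\<lambda>r. \<psi> (f (u + r * (v - u)))) ` {0..1} = {1..real k}"
    using reparameterization_subinterval[OF f uv] \<psi>(2) by simp
  show "mono_on {0..1} (\<lambda>r. \<psi> (f (u + r * (v - u))))"
  proof (rule mono_onI)
    fix r s :: real assume rs: "r \<in> {0..1}" "s \<in> {0..1}" "r \<le> s"
    then have "u + r * (v - u) \<le> u + s * (v - u)"
      using uv by (simp add: mult_right_mono)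
    moreover have "u + r * (v - u) \<in> {u..v}" "u + s * (v - u) \<in> {u..v}"
      using aff rs by blast+
    ultimately show "\<psi> (f (u + r * (v - u))) \<le> \<psi> (f (u + s * (v - u)))"
      using uv by (intro mono_onD[OF \<psi>(1)]) (auto intro!: reparameterization_mono[OF f])
  qed
qed

text \<open>The restricted matching compares the same pairs of points as the original one does
  during [u, v], so its cost cannot be larger.\<close>

lemma frechet_dist_matched_subcurves:
  assumes S: "is_curve S" and T: "is_curve T" and m: "bounded_matching \<delta> S T f g"
    and uv: "0 \<le> u" "u \<le> v" "v \<le> 1"
  shows "subcurve_range S (f u) (f v)" "subcurve_range T (g u) (g v)"
    "frechet_dist (subcurve S (f u) (f v)) (subcurve T (g u) (g v)) \<le> \<delta>"
proof -
  have mat: "matching S T f g" and cost: "matching_cost S T f g \<le> \<delta>"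
    using m unfolding bounded_matching_def by auto
  have f: "reparameterization (complexity S) f" and g: "reparameterization (complexity T) g"
    using mat unfolding matching_def by auto
  have le: "f u \<le> f v" "g u \<le> g v"
    using reparameterization_mono[OF f] reparameterization_mono[OF g] uv by auto
  show rS: "subcurve_range S (f u) (f v)" and rT: "subcurve_range T (g u) (g v)"
    unfolding subcurve_range_def
    using reparameterization_range[OF f, of u] reparameterization_range[OF f, of v]
      reparameterization_range[OF g, of u] reparameterization_range[OF g, of v] le uv by auto
  let ?\<psi> = "subcurve_position (f u) (f v)" and ?\<chi> = "subcurve_position (g u) (g v)"
  show "frechet_dist (subcurve S (f u) (f v)) (subcurve T (g u) (g v)) \<le> \<delta>"
  proof (rule frechet_dist_leI[OF is_curve_subcurve[OF S rS] is_curve_subcurve[OF T rT]])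
    show "matching (subcurve S (f u) (f v)) (subcurve T (g u) (g v))
        (\<lambda>r. ?\<psi> (f (u + r * (v - u)))) (\<lambda>r. ?\<chi> (g (u + r * (v - u))))"
      unfolding matching_def complexity_subcurve
      using le by (intro conjI reparameterization_restrict[OF f uv]
          reparameterization_restrict[OF g uv] subcurve_position_mono subcurve_position_image)
    fix r :: real assume r: "r \<in> {0..1}"
    define w where "w = u + r * (v - u)"
    have "0 \<le> r * (v - u)" "r * (v - u) \<le> v - u"
      using r uv by (simp_all add: mult_left_le_one_le)
    then have w: "u \<le> w" "w \<le> v" by (auto simp: w_def)
    then have "f w \<in> {f u..f v}" "g w \<in> {g u..g v}"
      using uv by (auto intro!: reparameterization_mono[OF f] reparameterization_mono[OF g])
    then have "norm (point (subcurve S (f u) (f v)) (?\<psi> (f w)) - point (subcurve T (g u) (g v)) (?\<chi> (g w)))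
        = norm (point S (f w) - point T (g w))"
      using le by (simp only: point_subcurve_position)
    also have "\<dots> \<le> \<delta>"
      using norm_le_matching_cost[OF S T mat, of w] cost w uv by auto
    finally show "norm (point (subcurve S (f u) (f v)) (?\<psi> (f (u + r * (v - u)))) -
        point (subcurve T (g u) (g v)) (?\<chi> (g (u + r * (v - u))))) \<le> \<delta>"
      unfolding w_def .
  qed
qed

lemma reparameterization_preimage_pair:
  assumes g: "reparameterization n g" and "1 \<le> a" "a \<le> b" "b \<le> real n"
  obtains u v where "0 \<le> u" "u \<le> v" "v \<le> 1" "g u = a" "g v = b"
proof -
  have "a \<in> {1..real n}" "b \<in> {1..real n}" using assms by auto
  then obtain u v where uv: "u \<in> {0..1}" "g u = a" "v \<in> {0..1}" "g v = b"
    using reparameterization_surj[OF g] by metis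
  show thesis
  proof (cases "u \<le> v")
    case True
    then show ?thesis using that uv by auto
  next
    \<comment> \<open>Preimages in the wrong order force a = b by monotonicity, and then u serves
      for both ends.\<close>
    case False
    then have "b \<le> a" using reparameterization_mono[OF g, of v u] uv by auto
    then show ?thesis using that[of u u] uv \<open>a \<le> b\<close> by auto
  qed
qed

theorem theorem7:
  fixes T S :: "(real ^ 'd) curve" and P :: "(real ^ 'd) curve"
    and f g :: "real \<Rightarrow> real" and \<Delta> :: real and l :: nat and \<I> :: "real set set"
  assumes "is_curve T"
    and "\<Delta> \<ge> 0"
    and "l \<ge> 2"
    and "pathlet_preserving_simplification T \<Delta> S f g"
    and "is_pathlet T l \<Delta> (P, \<I>)"
  shows "\<exists>s t. subcurve_range S s t \<and>
           is_pathlet T (l + 2 - card (\<nat> \<inter> {s, t})) (4 * \<Delta>) (subcurve S s t, \<I>)"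
proof -
  have S: "is_curve S" and bm: "bounded_matching (2 * \<Delta>) S T f g"
    and preserve: "\<And>a b P s t. subcurve_range T a b \<Longrightarrow> is_curve P \<Longrightarrow>
        frechet_dist P (subcurve T a b) \<le> \<Delta> \<Longrightarrow> matches_subcurve f g s t a b \<Longrightarrow>
        complexity (subcurve S s t) \<le> complexity P + 2 - card (\<nat> \<inter> {s, t})"
    using assms(4) unfolding pathlet_preserving_simplification_def by blast+
  have P: "is_curve P" "complexity P \<le> l"
    and \<I>: "\<And>J. J \<in> \<I> \<Longrightarrow> \<exists>a b. subcurve_range T a b \<and> J = {a..b} \<and>
        frechet_dist P (subcurve T a b) \<le> \<Delta>"
    using assms(5) unfolding is_pathlet_def by auto
  show ?thesis
  proof (cases "\<I> = {}")
    case True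
    \<comment> \<open>Without intervals only the complexity matters. The one-vertex subcurve at
      parameter 1 has complexity 1, and the bound to meet is l + 1.\<close>
    have range: "subcurve_range S 1 1"
      using S unfolding subcurve_range_def is_curve_def by simp
    have "complexity (subcurve S 1 1) = 1" "card (\<nat> \<inter> {1, 1 :: real}) = 1"
      by (simp_all add: complexity_subcurve subcurve_params_def)
    then show ?thesis
      using range is_curve_subcurve[OF S range] True unfolding is_pathlet_def
      by (intro exI[of _ 1]) simp
  next
    case False
    then obtain a b where ab: "subcurve_range T a b" "frechet_dist P (subcurve T a b) \<le> \<Delta>"
      using \<I> by blast
    have "reparameterization (complexity T) g"
      using bm unfolding bounded_matching_def matching_def by blast
    then obtain u v where uv: "0 \<le> u" "u \<le> v" "v \<le> 1" "g u = a" "g v = b"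
      using ab(1) reparameterization_preimage_pair unfolding subcurve_range_def by metis
    note sub = frechet_dist_matched_subcurves[OF S assms(1) bm uv(1-3), unfolded uv(4,5)]
    have "matches_subcurve f g (f u) (f v) a b"
      unfolding matches_subcurve_def using uv by blast
    then have "complexity (subcurve S (f u) (f v)) \<le> l + 2 - card (\<nat> \<inter> {f u, f v})"
      using preserve[OF ab(1) P(1) ab(2)] P(2) by fastforce
    moreover have "frechet_dist (subcurve S (f u) (f v)) (subcurve T a' b') \<le> 4 * \<Delta>"
      if "subcurve_range T a' b'" "frechet_dist P (subcurve T a' b') \<le> \<Delta>" for a' b'
    proof -
      note curves = is_curve_subcurve[OF S sub(1)] is_curve_subcurve[OF assms(1) ab(1)]
        is_curve_subcurve[OF assms(1) that(1)]
      have "frechet_dist (subcurve S (f u) (f v)) (subcurve T a' b') \<le>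
          frechet_dist (subcurve S (f u) (f v)) P + frechet_dist P (subcurve T a' b')"
        by (rule frechet_dist_triangle[OF curves(1) P(1) curves(3)])
      \<comment> \<open>A second triangle, through the chosen T[a, b], bounds the distance to P by
        \<open>2 * \<Delta> + \<Delta>\<close>; symmetry reverses the pathlet bound.\<close>
      also have "frechet_dist (subcurve S (f u) (f v)) P \<le>
          frechet_dist (subcurve S (f u) (f v)) (subcurve T a b) + frechet_dist P (subcurve T a b)"
        using frechet_dist_triangle[OF curves(1,2) P(1)] frechet_dist_sym[of P] by simp
      finally show ?thesis using sub(3) ab(2) that(2) by simp
    qed
    ultimately show ?thesis
      using sub(1) is_curve_subcurve[OF S sub(1)] \<I> unfolding is_pathlet_def
      by (intro exI[of _ "f u"] exI[of _ "f v"]) fastforce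
  qed
qed

end
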